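(* Fix $\delta\in(0,4)$. There is a function $\varepsilon(n)\to0$ as $n\to\infty$ such that for every $n$ and every symmetric strategy on $K_n$ (i.e. every distribution $\mathcal{D}$ over walk schedules over $[n]$, with both players' schedules $\mathbf{x},\mathbf{y}$ drawn independently from $\mathcal{D}$ and $\pi$ a uniformly random permutation of $[n]$ independent of them), with $T=(4-\delta)n$, \[ \Pr(\tau>T)\ge \frac{\mathrm{e}^{-4}}{4096}\,\mathrm{e}^{\delta/2}\,\delta^4-\varepsilon(n). \]
   Context: Rendezvous on the complete graph $K_n$: there are $n$ locations; each of two players labels them privately by $[n]$, and the labelings differ by a permutation $\pi$ of $[n]$. A player with walk schedule $\mathbf{x}$ (a sequence of labels) visits at step $t$ the location she labels $x_t$; the players meet at step $t$ iff $x_t=\pi(y_t)$, and $\tau=\min\{t:x_t=\pi(y_t)\}$. *)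

theory Defs
  imports "HOL-Probability.Probability" "HOL-Combinatorics.Permutations"
begin

text \<open>Walk schedules over \<open>[n] = {1..n}\<close> are infinite sequences of labels, with steps numbered
  \<open>1, 2, \<dots>\<close>, under the product sigma-algebra.\<close>

definition schedule_space :: "nat \<Rightarrow> (nat \<Rightarrow> nat) measure" where
  "schedule_space n = PiM {1..} (\<lambda>_. count_space {1..n})"

definition symmetric_strategy :: "nat \<Rightarrow> (nat \<Rightarrow> nat) measure \<Rightarrow> bool" where
  "symmetric_strategy n D \<longleftrightarrow> prob_space D \<and> sets D = sets (schedule_space n)"

text \<open>The law of \<open>(x, y, \<pi>)\<close>: the schedules \<open>x\<close> and \<open>y\<close> are drawn from \<open>D\<close>, the permutation \<open>\<pi>\<close> is
  uniform, and all three are independent.\<close>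

definition rendezvous_measure ::
    "nat \<Rightarrow> (nat \<Rightarrow> nat) measure \<Rightarrow> ((nat \<Rightarrow> nat) \<times> (nat \<Rightarrow> nat) \<times> (nat \<Rightarrow> nat)) measure" where
  "rendezvous_measure n D = D \<Otimes>\<^sub>M (D \<Otimes>\<^sub>M uniform_count_measure {\<pi>. \<pi> permutes {1..n}})"

text \<open>The meeting time is \<open>\<infinity>\<close> if the players never meet.\<close>

definition meeting_time :: "(nat \<Rightarrow> nat) \<Rightarrow> (nat \<Rightarrow> nat) \<Rightarrow> (nat \<Rightarrow> nat) \<Rightarrow> enat" where
  "meeting_time x y \<pi> = Inf {enat t | t. t \<ge> 1 \<and> x t = \<pi> (y t)}"

end

theory Submission
  imports Defs
begin

text \<open>
  Let \<open>N = \<lfloor>(4 - \<delta>) n\<rfloor>\<close>. Call a label heavy for a schedule if it is used at least \<open>n / 400\<close> times up to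
  step \<open>N\<close>; there are boundedly many heavy labels. Let \<open>S x\<close> be the set of steps at which \<open>x\<close> is at a
  heavy label, and put \<open>u = |S x - S y| / n\<close>, \<open>v = |S y - S x| / n\<close>.

  For fixed \<open>x\<close> and \<open>y\<close> the players fail to meet iff \<open>\<pi>\<close> avoids the pairs \<open>(y t, x t)\<close>, and this has
  probability at least about \<open>(1 - u) (1 - v) exp (u + v - (4 - \<delta>))\<close>: the pairs at heavy labels of \<open>y\<close>
  cost a factor \<open>1 - v\<close>, those at heavy labels of \<open>x\<close> a factor \<open>1 - u\<close> (the boundedly many pairs of two
  heavy labels are negligible), and each remaining pair about \<open>1 - 1 / n\<close>. All three estimates come
  from one switching argument: among the permutations avoiding \<open>E\<close>, the proportion mapping \<open>i\<close> to \<open>j\<close>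
  is at most \<open>1 / (n - deg i - deg j)\<close>.

  It remains to see that \<open>u\<close> and \<open>v\<close> are both bounded away from \<open>1\<close> with constant probability. Sort the
  schedules into at most \<open>32 / \<delta>\<close> classes by the size of \<open>S\<close>, up to \<open>\<delta> n / 8\<close>. Two independent schedules
  lie in the same class with probability at least \<open>\<delta> / 32\<close>, and then \<open>u\<close> and \<open>v\<close> are nearly equal. Within
  a class each step lies in the symmetric difference of \<open>S x\<close> and \<open>S y\<close> with probability
  \<open>2 p (1 - p) \<le> 1 / 2\<close>, so \<open>u + v\<close> has mean at most \<open>2 - \<delta> / 2\<close>, and it is at most \<open>2 - \<delta> / 4\<close> with
  probability at least \<open>\<delta> / 8\<close>.
\<close>

section \<open>Permutations avoiding a set of pairs\<close>

definition avoiding :: "'a set \<Rightarrow> ('a \<times> 'a) set \<Rightarrow> ('a \<Rightarrow> 'a) set" where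
  "avoiding V E = {\<pi>. \<pi> permutes V \<and> (\<forall>(i, j)\<in>E. \<pi> i \<noteq> j)}"

lemma finite_avoiding: "finite V \<Longrightarrow> finite (avoiding V E)"
  unfolding avoiding_def by (rule finite_subset[OF _ finite_permutations]) auto

lemma avoiding_empty: "avoiding V {} = {\<pi>. \<pi> permutes V}"
  by (simp add: avoiding_def)

text \<open>Switching: if \<open>\<pi> i = j\<close>, composing \<open>\<pi>\<close> with the
  transposition of \<open>i\<close> and \<open>k\<close> sends \<open>i\<close> to
  \<open>\<pi> k\<close> and \<open>k\<close> to \<open>j\<close> and leaves all other values alone.
  The result can violate \<open>E\<close> only at these two places, which spoils at most
  \<open>card (E\<close> {i})\<open>choices of\<close>k\<open>through the first and\<close>card
  (E\<inverse> \<open>{j})\<close> through the second.\<close>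

lemma card_avoiding_edge_le:
  fixes E :: "('a \<times> 'a) set"
  assumes V: "finite V" and E: "finite E" and iV: "i \<in> V" and jV: "j \<in> V"
    and d: "real (card (E `` {i})) + real (card (E\<inverse> `` {j})) \<le> d"
  shows "real (card {\<pi> \<in> avoiding V E. \<pi> i = j}) * (real (card V) - d) \<le> real (card (avoiding V E))"
proof -
  define P where "P = {\<pi> \<in> avoiding V E. \<pi> i = j}"
  \<comment> \<open>\<open>Q \<pi>\<close> is the set of admissible switches. It contains
    \<open>k = i\<close>, the trivial switch, because \<open>\<pi>\<close> avoids \<open>E\<close>
    and so \<open>(i, j)\<close> is not in \<open>E\<close>; hence nothing beyond the two degrees is
    lost from \<open>card V\<close>.\<close>
  define Q where "Q = (\<lambda>\<pi>. {k \<in> V. (i, \<pi> k) \<notin> E \<and> (k, j) \<notin> E})"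
  define sw where "sw = (\<lambda>(\<pi> :: 'a \<Rightarrow> 'a, k). \<pi> \<circ> Transposition.transpose i k)"
  have finP: "finite P"
    using finite_avoiding[OF V] by (simp add: P_def)
  have finQ: "finite (Q \<pi>)" for \<pi>
    using V by (simp add: Q_def)
  have Qcard: "real (card V) - d \<le> real (card (Q \<pi>))" if "\<pi> \<in> P" for \<pi>
  proof -
    have perm: "\<pi> permutes V" using that by (simp add: P_def avoiding_def)
    have "V = Q \<pi> \<union> {k \<in> V. (i, \<pi> k) \<in> E} \<union> {k \<in> V. (k, j) \<in> E}"
      by (auto simp: Q_def)
    then have "card V \<le> card (Q \<pi>) + card {k \<in> V. (i, \<pi> k) \<in> E} + card {k \<in> V. (k, j) \<in> E}"
      by (metis (no_types, lifting) card_Un_le le_trans add_le_mono1)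
    moreover have "card {k \<in> V. (i, \<pi> k) \<in> E} \<le> card (E `` {i})"
      using E permutes_inj[OF perm]
      by (intro card_inj_on_le[of \<pi>]) (auto simp: inj_on_def inj_def)
    moreover have "card {k \<in> V. (k, j) \<in> E} \<le> card (E\<inverse> `` {j})"
      using E by (intro card_mono) auto
    ultimately show ?thesis using d by linarith
  qed
  have "inj_on sw (Sigma P Q)"
  proof (rule inj_onI, clarify)
    fix \<pi> k \<rho> l
    assume a: "\<pi> \<in> P" "k \<in> Q \<pi>" "\<rho> \<in> P" "l \<in> Q \<rho>" and eq: "sw (\<pi>, k) = sw (\<rho>, l)"
    have inj: "inj (\<pi> \<circ> Transposition.transpose i k)"
      using a by (auto simp: P_def avoiding_def intro!: inj_compose intro: permutes_inj)
    \<comment> \<open>Injectivity: \<open>k\<close> is recovered from the switched permutation as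
      the only point sent to \<open>j\<close>, and then \<open>\<pi>\<close> by undoing the
      transposition.\<close>
    have "(\<pi> \<circ> Transposition.transpose i k) k = j" "(\<rho> \<circ> Transposition.transpose i l) l = j"
      using a by (auto simp: P_def)
    then have "(\<pi> \<circ> Transposition.transpose i k) k = (\<pi> \<circ> Transposition.transpose i k) l"
      using eq unfolding sw_def prod.case by metis
    then have "k = l" using inj by (meson injD)
    moreover have "(\<pi> \<circ> Transposition.transpose i k) \<circ> Transposition.transpose i k = (\<rho> \<circ> Transposition.transpose i k) \<circ> Transposition.transpose i k"
      using eq \<open>k = l\<close> by (simp add: sw_def)
    ultimately show "\<pi> = \<rho> \<and> k = l"
      by (simp add: comp_assoc)
  qed
  moreover have "sw ` Sigma P Q \<subseteq> avoiding V E"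
  proof clarify
    fix \<pi> k assume a: "\<pi> \<in> P" "k \<in> Q \<pi>"
    have "\<pi> \<circ> Transposition.transpose i k permutes V"
      using a iV by (auto simp: P_def Q_def avoiding_def intro!: permutes_compose permutes_swap_id)
    moreover have "(\<pi> \<circ> Transposition.transpose i k) a \<noteq> b" if "(a, b) \<in> E" for a b
      using a that by (auto simp: P_def Q_def avoiding_def Transposition.transpose_def)
    ultimately show "sw (\<pi>, k) \<in> avoiding V E"
      by (auto simp: sw_def avoiding_def)
  qed
  ultimately have "card (Sigma P Q) \<le> card (avoiding V E)"
    by (rule card_inj_on_le) (rule finite_avoiding[OF V])
  moreover have "real (card (Sigma P Q)) = (\<Sum>\<pi>\<in>P. real (card (Q \<pi>)))"
    using finP finQ by simp
  moreover have "real (card P) * (real (card V) - d) \<le> (\<Sum>\<pi>\<in>P. real (card (Q \<pi>)))"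
    using sum_bounded_below[of P "real (card V) - d" "\<lambda>\<pi>. real (card (Q \<pi>))"] Qcard by simp
  ultimately show ?thesis
    unfolding P_def[symmetric] by linarith
qed

text \<open>Union bound over the pairs of \<open>F\<close>, each hit by a proportion of at most
  \<open>1 / (card V - d)\<close>. Only degrees in \<open>E\<close> enter, so \<open>F\<close>
  itself may have large degrees; this is what suits pairs at heavy labels.\<close>

lemma card_avoiding_Un_ge:
  fixes E F :: "('a \<times> 'a) set"
  assumes V: "finite V" and E: "finite E" and F: "finite F" "F \<subseteq> V \<times> V"
    and d: "\<And>i j. (i, j) \<in> F \<Longrightarrow> real (card (E `` {i})) + real (card (E\<inverse> `` {j})) \<le> d"
    and dn: "d < real (card V)"
  shows "real (card (avoiding V E)) * (1 - real (card F) / (real (card V) - d))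
          \<le> real (card (avoiding V (E \<union> F)))"
proof -
  let ?hit = "\<lambda>e. {\<pi> \<in> avoiding V E. \<pi> (fst e) = snd e}"
  have "avoiding V E \<subseteq> avoiding V (E \<union> F) \<union> (\<Union>e\<in>F. ?hit e)"
    by (auto simp: avoiding_def)
  then have "card (avoiding V E) \<le> card (avoiding V (E \<union> F) \<union> (\<Union>e\<in>F. ?hit e))"
    using F V by (intro card_mono) (auto simp: finite_avoiding)
  also have "\<dots> \<le> card (avoiding V (E \<union> F)) + (\<Sum>e\<in>F. card (?hit e))"
    using card_Un_le card_UN_le[OF F(1), of ?hit] by (meson add_left_mono order_trans)
  finally have "real (card (avoiding V E)) \<le>
      real (card (avoiding V (E \<union> F))) + (\<Sum>e\<in>F. real (card (?hit e)))"
    by (simp flip: of_nat_add of_nat_sum)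
  also have "(\<Sum>e\<in>F. real (card (?hit e))) \<le>
      (\<Sum>e\<in>F. real (card (avoiding V E)) / (real (card V) - d))"
  proof (rule sum_mono)
    fix e assume e: "e \<in> F"
    have "real (card (?hit e)) * (real (card V) - d) \<le> real (card (avoiding V E))"
      using e F d[of "fst e" "snd e"] by (intro card_avoiding_edge_le[OF V E]) auto
    then show "real (card (?hit e)) \<le> real (card (avoiding V E)) / (real (card V) - d)"
      using dn by (simp add: pos_le_divide_eq)
  qed
  finally show ?thesis by (simp add: algebra_simps)
qed

text \<open>Adding the pairs of \<open>F\<close> one at a time gives a product instead of the linear
  loss of the union bound. The pairs added earlier now count towards the degrees, which are
  therefore bounded in a set \<open>G\<close> containing everything.\<close>

lemma card_avoiding_Un_ge_power:
  fixes E F G :: "('a \<times> 'a) set"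
  assumes V: "finite V" and G: "finite G" and EG: "E \<subseteq> G" and "F \<subseteq> G" "F \<subseteq> V \<times> V"
    and d: "\<And>i j. (i, j) \<in> F \<Longrightarrow> real (card (G `` {i})) + real (card (G\<inverse> `` {j})) \<le> d"
    and dn: "d \<le> real (card V) - 1"
  shows "real (card (avoiding V E)) * (1 - 1 / (real (card V) - d)) ^ card F
          \<le> real (card (avoiding V (E \<union> F)))"
proof -
  have "finite F" using assms finite_subset by blast
  then show ?thesis using \<open>F \<subseteq> G\<close> \<open>F \<subseteq> V \<times> V\<close> d
  proof (induction F rule: finite_induct)
    case (insert e F)
    let ?q = "1 - 1 / (real (card V) - d)"
    obtain i j where e: "e = (i, j)" by (cases e)
    have "0 \<le> ?q" using dn by simp
    have "card ((E \<union> F) `` {i}) \<le> card (G `` {i})" "card ((E \<union> F)\<inverse> `` {j}) \<le> card (G\<inverse> `` {j})"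
      using insert.prems EG G by (auto intro!: card_mono finite_Image)
    then have deg: "real (card ((E \<union> F) `` {i})) + real (card ((E \<union> F)\<inverse> `` {j})) \<le> d"
      using insert.prems(3)[of i j] by (simp add: e)
    have "real (card (avoiding V E)) * ?q ^ card (insert e F)
        = (real (card (avoiding V E)) * ?q ^ card F) * ?q"
      using insert.hyps by simp
    also have "\<dots> \<le> real (card (avoiding V (E \<union> F))) * ?q"
      using insert \<open>0 \<le> ?q\<close> by (intro mult_right_mono) auto
    also have "\<dots> \<le> real (card (avoiding V ((E \<union> F) \<union> {e})))"
      using card_avoiding_Un_ge[of V "E \<union> F" "{e}" d] V insert dn EG finite_subset[OF EG G] deg
      by (auto simp: e)
    finally show ?case by simp
  qed simp
qed

section \<open>Heavy labels\<close>

definition heavy :: "nat \<Rightarrow> real \<Rightarrow> (nat \<Rightarrow> 'a) \<Rightarrow> 'a set" where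
  "heavy N h x = {a. h \<le> real (card {s \<in> {1..N}. x s = a})}"

definition heavy_times :: "nat \<Rightarrow> real \<Rightarrow> (nat \<Rightarrow> 'a) \<Rightarrow> nat set" where
  "heavy_times N h x = {t \<in> {1..N}. x t \<in> heavy N h x}"

lemma heavy_subset: "0 < h \<Longrightarrow> heavy N h x \<subseteq> x ` {1..N}"
proof
  fix a assume h: "0 < h" and a: "a \<in> heavy N h x"
  show "a \<in> x ` {1..N}"
  proof (rule ccontr)
    assume "a \<notin> x ` {1..N}"
    then have no: "{s \<in> {1..N}. x s = a} = {}" by blast
    show False using a h unfolding heavy_def mem_Collect_eq no by simp
  qed
qed

lemma finite_heavy: "0 < h \<Longrightarrow> finite (heavy N h x)"
  by (rule finite_subset[OF heavy_subset]) auto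

text \<open>Each heavy label occupies at least \<open>h\<close> of the \<open>N\<close> steps, and
  distinct labels occupy disjoint sets of steps.\<close>

lemma card_heavy_le:
  assumes "0 < h"
  shows "real (card (heavy N h x)) * h \<le> real N"
proof -
  let ?T = "\<lambda>a. {s \<in> {1..N}. x s = a}"
  have "real (card (heavy N h x)) * h \<le> (\<Sum>a\<in>heavy N h x. real (card (?T a)))"
    by (rule sum_bounded_below) (simp add: heavy_def)
  also have "\<dots> = real (card (\<Union>a\<in>heavy N h x. ?T a))"
    by (subst card_UN_disjoint) (auto simp: finite_heavy[OF assms])
  also have "\<dots> \<le> real (card {1..N})"
    by (intro of_nat_mono card_mono) auto
  finally show ?thesis by simp
qed

lemma heavy_times_subset: "heavy_times N h x \<subseteq> {1..N}"
  by (auto simp: heavy_times_def)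

text \<open>The pairs are forbidden in three rounds. \<open>F1\<close>, where \<open>y\<close> is
  heavy, starts from no constraints, so its degree bound is \<open>0\<close>. For
  \<open>(i, j)\<close> in \<open>F2\<close>, where only \<open>x\<close> is heavy,
  \<open>F1\<close> has no pair starting at \<open>i\<close>, and its pairs ending at
  \<open>j\<close> start at heavy labels of \<open>y\<close>, so the degree bound is
  \<open>K\<close>. For \<open>F3\<close>, where both labels are light, each degree is below
  \<open>h\<close>, and the product bound applies.\<close>

lemma card_avoiding_schedules_ge:
  fixes x y :: "nat \<Rightarrow> 'a" and N :: nat and h :: real
  defines "ed \<equiv> \<lambda>t. (y t, x t)" and "A \<equiv> heavy_times N h x" and "B \<equiv> heavy_times N h y"
  assumes V: "finite V" and xV: "x ` {1..N} \<subseteq> V" and yV: "y ` {1..N} \<subseteq> V"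
    and h: "0 < h" "2 * h \<le> real (card V) - 1"
    and K: "real (card (heavy N h x)) \<le> K" "real (card (heavy N h y)) \<le> K" "K < real (card V)"
    and A: "real (card (A - B)) \<le> real (card V) - K"
  shows "fact (card V) * (1 - (real (card (B - A)) + K\<^sup>2) / real (card V))
            * (1 - real (card (A - B)) / (real (card V) - K))
            * (1 - 1 / (real (card V) - 2 * h)) ^ (N - card (sym_diff A B))
          \<le> real (card (avoiding V (ed ` {1..N})))"
proof -
  define F1 where "F1 = ed ` B"
  define F2 where "F2 = ed ` (A - B)"
  define F3 where "F3 = ed ` ({1..N} - (A \<union> B))"
  let ?n = "real (card V)"
  let ?q = "1 - 1 / (?n - 2 * h)"
  note fin = finite_heavy[OF h(1), of N]
  have AB: "A \<subseteq> {1..N}" "B \<subseteq> {1..N}"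
    by (auto simp: A_def B_def heavy_times_def)
  then have finAB: "finite A" "finite B" by (auto intro: finite_subset)
  have Un: "ed ` {1..N} = (F1 \<union> F2) \<union> F3"
  proof -
    have "{1..N} = B \<union> (A - B) \<union> ({1..N} - (A \<union> B))" using AB by blast
    from arg_cong[OF this, of "image ed"] show ?thesis
      unfolding F1_def F2_def F3_def image_Un .
  qed
  have sub: "ed ` {1..N} \<subseteq> V \<times> V"
    using xV yV by (auto simp: ed_def)
  have finE: "finite (ed ` {1..N})" by simp
  have F_sub: "F1 \<subseteq> V \<times> V" "F2 \<subseteq> V \<times> V" "F3 \<subseteq> V \<times> V"
    and F_fin: "finite F1" "finite F2" "finite F3"
    and F_E: "F1 \<union> F2 \<subseteq> ed ` {1..N}" "F3 \<subseteq> ed ` {1..N}"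
    using sub finE unfolding Un by auto
  have "K \<ge> 0" using K(1) of_nat_0_le_iff order_trans by blast

  \<comment> \<open>However many steps \<open>A \<inter> B\<close> has, they yield only pairs of two
    heavy labels, hence at most \<open>K^2\<close> different constraints.\<close>
  have "card F1 \<le> card (ed ` (B - A)) + card (ed ` (A \<inter> B))"
  proof -
    have "F1 = ed ` (B - A) \<union> ed ` (A \<inter> B)" by (auto simp: F1_def)
    then show ?thesis by (simp add: card_Un_le)
  qed
  also have "card (ed ` (B - A)) \<le> card (B - A)"
    using finAB by (intro card_image_le) auto
  also have "card (ed ` (A \<inter> B)) \<le> card (heavy N h y \<times> heavy N h x)"
    using fin by (intro card_mono) (auto simp: ed_def A_def B_def heavy_times_def)
  finally have "real (card F1) \<le> real (card (B - A)) + real (card (heavy N h y)) * real (card (heavy N h x))"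
    by (simp add: card_cartesian_product flip: of_nat_mult of_nat_add)
  also have "real (card (heavy N h y)) * real (card (heavy N h x)) \<le> K\<^sup>2"
    unfolding power2_eq_square using K by (intro mult_mono) auto
  finally have F1: "real (card F1) \<le> real (card (B - A)) + K\<^sup>2" by simp
  have "fact (card V) * (1 - (real (card (B - A)) + K\<^sup>2) / ?n) \<le> fact (card V) * (1 - real (card F1) / (?n - 0))"
    using F1 by (intro mult_left_mono) (auto intro!: divide_right_mono)
  also have "\<dots> = real (card (avoiding V {})) * (1 - real (card F1) / (?n - 0))"
    by (simp add: avoiding_empty card_permutations[OF refl V])
  also have "\<dots> \<le> real (card (avoiding V ({} \<union> F1)))"
    using V K \<open>K \<ge> 0\<close> F_sub F_fin by (intro card_avoiding_Un_ge) auto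
  finally have step1: "fact (card V) * (1 - (real (card (B - A)) + K\<^sup>2) / ?n) \<le> real (card (avoiding V F1))"
    by simp

  have "card F2 \<le> card (A - B)"
    unfolding F2_def using finAB by (intro card_image_le) auto
  then have "1 - real (card (A - B)) / (?n - K) \<le> 1 - real (card F2) / (?n - K)"
    using K by (auto intro!: divide_right_mono)
  then have "real (card (avoiding V F1)) * (1 - real (card (A - B)) / (?n - K))
      \<le> real (card (avoiding V F1)) * (1 - real (card F2) / (?n - K))"
    by (intro mult_left_mono) auto
  also have "\<dots> \<le> real (card (avoiding V (F1 \<union> F2)))"
  proof (rule card_avoiding_Un_ge[OF V])
    fix i j assume "(i, j) \<in> F2"
    then have "i \<notin> heavy N h y"
      by (auto simp: F2_def ed_def A_def B_def heavy_times_def)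
    then have "F1 `` {i} = {}"
      by (auto simp: F1_def ed_def B_def heavy_times_def)
    moreover have "card (F1\<inverse> `` {j}) \<le> card (heavy N h y)"
      using fin by (intro card_mono) (auto simp: F1_def ed_def B_def heavy_times_def)
    ultimately show "real (card (F1 `` {i})) + real (card (F1\<inverse> `` {j})) \<le> K"
      using K by simp
  qed (use F_sub F_fin K in auto)
  finally have step2: "real (card (avoiding V F1)) * (1 - real (card (A - B)) / (?n - K))
      \<le> real (card (avoiding V (F1 \<union> F2)))" .

  have q: "0 \<le> ?q" "?q \<le> 1" using h by auto
  have "card F3 \<le> card ({1..N} - (A \<union> B))"
    unfolding F3_def by (intro card_image_le) auto
  also have "\<dots> = N - card (A \<union> B)"
    using AB finAB by (subst card_Diff_subset) auto
  \<comment> \<open>Discarding the gain from \<open>A \<inter> B\<close> leaves an exponent that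
    depends on the symmetric difference alone, the quantity controlled on average later.\<close>
  also have "\<dots> \<le> N - card (sym_diff A B)"
    using finAB by (intro diff_le_mono2 card_mono) auto
  finally have "?q ^ (N - card (sym_diff A B)) \<le> ?q ^ card F3"
    using q by (intro power_decreasing) auto
  then have "real (card (avoiding V (F1 \<union> F2))) * ?q ^ (N - card (sym_diff A B))
      \<le> real (card (avoiding V (F1 \<union> F2))) * ?q ^ card F3"
    by (intro mult_left_mono) auto
  also have "\<dots> \<le> real (card (avoiding V ((F1 \<union> F2) \<union> F3)))"
  proof (rule card_avoiding_Un_ge_power[OF V finE])
    fix i j assume "(i, j) \<in> F3"
    then have light: "i \<notin> heavy N h y" "j \<notin> heavy N h x"
      by (auto simp: F3_def ed_def A_def B_def heavy_times_def)
    have "card ((ed ` {1..N}) `` {i}) \<le> card (x ` {s \<in> {1..N}. y s = i})"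
      by (intro card_mono) (auto simp: ed_def)
    also have "\<dots> \<le> card {s \<in> {1..N}. y s = i}" by (intro card_image_le) auto
    finally have 1: "card ((ed ` {1..N}) `` {i}) \<le> card {s \<in> {1..N}. y s = i}" .
    have "card ((ed ` {1..N})\<inverse> `` {j}) \<le> card (y ` {s \<in> {1..N}. x s = j})"
      by (intro card_mono) (auto simp: ed_def)
    also have "\<dots> \<le> card {s \<in> {1..N}. x s = j}" by (intro card_image_le) auto
    finally have 2: "card ((ed ` {1..N})\<inverse> `` {j}) \<le> card {s \<in> {1..N}. x s = j}" .
    show "real (card ((ed ` {1..N}) `` {i})) + real (card ((ed ` {1..N})\<inverse> `` {j})) \<le> 2 * h"
      using light 1 2 unfolding heavy_def mem_Collect_eq by linarith
  qed (use h F_sub F_E in simp_all)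
  finally have step3: "real (card (avoiding V (F1 \<union> F2))) * ?q ^ (N - card (sym_diff A B))
      \<le> real (card (avoiding V (ed ` {1..N})))"
    unfolding Un .

  have "0 \<le> 1 - real (card (A - B)) / (?n - K)" using A K by simp
  note order_trans[OF mult_right_mono[OF step1 this] step2]
  from order_trans[OF mult_right_mono[OF this zero_le_power[OF q(1)]] step3]
  show ?thesis .
qed

section \<open>Pairs of similar schedules\<close>

text \<open>Double counting over \<open>t\<close> in \<open>U\<close>: if the sets containing
  \<open>t\<close> have weight \<open>P t\<close> out of the total \<open>q\<close>, the ordered
  pairs separated by \<open>t\<close> have weight \<open>2 * P t * (q - P t)\<close>, which is at
  most \<open>q^2 / 2\<close> because \<open>(q - 2 * P t)^2\<close> is nonnegative.\<close>

lemma sum_card_symmetric_difference_le: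
  fixes p :: "'a \<Rightarrow> real" and S :: "'a \<Rightarrow> 'b set"
  assumes U: "finite U" and S: "\<And>f. f \<in> W \<Longrightarrow> S f \<subseteq> U"
  shows "(\<Sum>(f, g)\<in>W \<times> W. p f * p g * real (card (sym_diff (S f) (S g))))
          \<le> real (card U) / 2 * (\<Sum>f\<in>W. p f)\<^sup>2"
proof -
  define ind where "ind = (\<lambda>f t. of_bool (t \<in> S f) :: real)"
  define q where "q = (\<Sum>f\<in>W. p f)"
  define P where "P = (\<lambda>t. \<Sum>f\<in>W. p f * ind f t)"
  have card: "real (card (sym_diff (S f) (S g))) = (\<Sum>t\<in>U. ind f t + ind g t - 2 * ind f t * ind g t)"
    if "f \<in> W" "g \<in> W" for f g
  proof -
    have "(\<Sum>t\<in>U. ind f t + ind g t - 2 * ind f t * ind g t)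
        = (\<Sum>t\<in>U. if t \<in> (S f - S g) \<union> (S g - S f) then 1 else 0)"
      by (intro sum.cong) (auto simp: ind_def)
    also have "\<dots> = real (card (U \<inter> (sym_diff (S f) (S g))))"
      using U by (auto simp: sum.If_cases intro!: arg_cong[where f = card])
    also have "U \<inter> (sym_diff (S f) (S g)) = (S f - S g) \<union> (S g - S f)"
      using S that by blast
    finally show ?thesis by simp
  qed
  have "(\<Sum>(f, g)\<in>W \<times> W. p f * p g * real (card (sym_diff (S f) (S g))))
      = (\<Sum>f\<in>W. \<Sum>g\<in>W. \<Sum>t\<in>U. p f * p g * (ind f t + ind g t - 2 * ind f t * ind g t))"
    unfolding sum.cartesian_product[symmetric]
    by (intro sum.cong refl) (simp only: card sum_distrib_left)
  also have "\<dots> = (\<Sum>f\<in>W. \<Sum>t\<in>U. \<Sum>g\<in>W. p f * p g * (ind f t + ind g t - 2 * ind f t * ind g t))"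
    by (intro sum.cong refl sum.swap)
  also have "\<dots> = (\<Sum>t\<in>U. \<Sum>f\<in>W. \<Sum>g\<in>W. p f * p g * (ind f t + ind g t - 2 * ind f t * ind g t))"
    by (rule sum.swap)
  also have "\<dots> = (\<Sum>t\<in>U. 2 * P t * q - 2 * (P t)\<^sup>2)"
  proof (intro sum.cong refl)
    fix t
    have "(\<Sum>f\<in>W. \<Sum>g\<in>W. p f * p g * (ind f t + ind g t - 2 * ind f t * ind g t))
       = (\<Sum>f\<in>W. \<Sum>g\<in>W. (p f * ind f t) * p g + p f * (p g * ind g t) - 2 * ((p f * ind f t) * (p g * ind g t)))"
      by (intro sum.cong refl) (simp add: algebra_simps)
    also have "\<dots> = P t * q + q * P t - 2 * (P t * P t)"
      by (simp add: sum.distrib sum_subtractf sum_product P_def q_def flip: sum_distrib_left)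
    finally show "(\<Sum>f\<in>W. \<Sum>g\<in>W. p f * p g * (ind f t + ind g t - 2 * ind f t * ind g t)) = 2 * P t * q - 2 * (P t)\<^sup>2"
      by (simp add: power2_eq_square)
  qed
  also have "\<dots> \<le> (\<Sum>t\<in>U. q\<^sup>2 / 2)"
  proof (rule sum_mono)
    fix t
    have "0 \<le> (q - 2 * P t)\<^sup>2" by simp
    then show "2 * P t * q - 2 * (P t)\<^sup>2 \<le> q\<^sup>2 / 2"
      by (simp add: power2_eq_square algebra_simps)
  qed
  finally show ?thesis by (simp add: q_def)
qed

text \<open>By Cauchy-Schwarz, pairs within one of the \<open>k\<close> classes have weight at least
  \<open>1 / k\<close>. Inside a class the distance averages at most \<open>card U / 2\<close>, so a
  Markov-type argument on \<open>M\<close> minus the distance leaves enough weight on pairs at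
  distance at most \<open>M\<close>.\<close>

lemma similar_pair_weight_ge:
  fixes p :: "'a \<Rightarrow> real" and S :: "'a \<Rightarrow> 'b set" and b :: "'a \<Rightarrow> nat" and M :: real
  assumes W: "finite W" and U: "finite U" and S: "\<And>f. f \<in> W \<Longrightarrow> S f \<subseteq> U"
    and p: "\<And>f. f \<in> W \<Longrightarrow> 0 \<le> p f" "(\<Sum>f\<in>W. p f) = 1"
    and b: "\<And>f. f \<in> W \<Longrightarrow> b f < k" and M: "0 < M" "real (card U) / 2 \<le> M"
  shows "(M - real (card U) / 2) / (M * real k)
    \<le> (\<Sum>(f, g)\<in>{(f, g) \<in> W \<times> W. b f = b g \<and> real (card (sym_diff (S f) (S g))) \<le> M}. p f * p g)"
proof -
  let ?d = "\<lambda>f g. real (card (sym_diff (S f) (S g)))"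
  define B where "B = (\<lambda>i. {f \<in> W. b f = i})"
  define q where "q = (\<lambda>i. \<Sum>f\<in>B i. p f)"
  define R where "R = {(f, g) \<in> W \<times> W. b f = b g}"
  define R' where "R' = {(f, g) \<in> W \<times> W. b f = b g \<and> ?d f g \<le> M}"
  have finB: "finite (B i)" for i using W by (simp add: B_def)
  have finR: "finite R" using W by (auto simp: R_def intro: finite_subset[of _ "W \<times> W"])
  have R: "R = (\<Union>i\<in>{..<k}. B i \<times> B i)"
    using b by (auto simp: R_def B_def)
  have sumR: "sum G R = (\<Sum>i<k. sum G (B i \<times> B i))" for G :: "'a \<times> 'a \<Rightarrow> real"
    unfolding R by (rule sum.UNION_disjoint) (auto simp: finB, auto simp: B_def)
  have "k > 0" using p(2) b by (cases "W = {}") fastforce+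
  have "1 = (\<Sum>f\<in>W. p f)\<^sup>2" using p by simp
  also have "W = (\<Union>i\<in>{..<k}. B i)" using b by (auto simp: B_def)
  also have "(\<Sum>f\<in>(\<Union>i\<in>{..<k}. B i). p f) = (\<Sum>i<k. q i)"
    unfolding q_def by (rule sum.UNION_disjoint) (auto simp: finB, auto simp: B_def)
  also have "(\<Sum>i<k. q i)\<^sup>2 \<le> (\<Sum>i<k. (q i)\<^sup>2) * real (card {..<k})"
    by (rule sum_squared_le_sum_of_squares)
  finally have "1 / real k \<le> (\<Sum>i<k. (q i)\<^sup>2)"
    using \<open>k > 0\<close> by (simp add: pos_divide_le_eq)
  then have "(M - real (card U) / 2) * (1 / real k) \<le> (M - real (card U) / 2) * (\<Sum>i<k. (q i)\<^sup>2)"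
    using M by (intro mult_left_mono) auto
  also have "\<dots> = (\<Sum>i<k. M * (q i)\<^sup>2 - real (card U) / 2 * (q i)\<^sup>2)"
    by (simp add: sum_subtractf sum_distrib_left left_diff_distrib)
  also have "\<dots> \<le> (\<Sum>i<k. \<Sum>(f, g)\<in>B i \<times> B i. p f * p g * (M - ?d f g))"
  proof (rule sum_mono)
    fix i
    have "(\<Sum>(f, g)\<in>B i \<times> B i. p f * p g * ?d f g) \<le> real (card U) / 2 * (q i)\<^sup>2"
      unfolding q_def using S by (intro sum_card_symmetric_difference_le U) (auto simp: B_def)
    moreover have "(\<Sum>(f, g)\<in>B i \<times> B i. p f * p g * (M - ?d f g))
        = M * (\<Sum>(f, g)\<in>B i \<times> B i. p f * p g) - (\<Sum>(f, g)\<in>B i \<times> B i. p f * p g * ?d f g)"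
      by (simp add: sum_distrib_left sum_subtractf[symmetric] case_prod_beta algebra_simps)
    moreover have "(\<Sum>(f, g)\<in>B i \<times> B i. p f * p g) = (q i)\<^sup>2"
      unfolding q_def power2_eq_square sum_product sum.cartesian_product ..
    ultimately show "M * (q i)\<^sup>2 - real (card U) / 2 * (q i)\<^sup>2 \<le> (\<Sum>(f, g)\<in>B i \<times> B i. p f * p g * (M - ?d f g))"
      by simp
  qed
  also have "\<dots> = (\<Sum>(f, g)\<in>R. p f * p g * (M - ?d f g))"
    by (rule sumR[symmetric])
  \<comment> \<open>The Markov step: \<open>M - ?d f g\<close> is at most \<open>M\<close> on
    \<open>R'\<close> and negative on the rest of \<open>R\<close>.\<close>
  also have "\<dots> \<le> (\<Sum>e\<in>R. if e \<in> R' then M * (p (fst e) * p (snd e)) else 0)"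
  proof (rule sum_mono, clarify)
    fix f g assume "(f, g) \<in> R"
    then have fg: "0 \<le> p f * p g" "(f, g) \<in> R' \<longleftrightarrow> ?d f g \<le> M" using p by (auto simp: R_def R'_def)
    show "p f * p g * (M - ?d f g) \<le> (if (f, g) \<in> R' then M * (p (fst (f, g)) * p (snd (f, g))) else 0)"
    proof (cases "?d f g \<le> M")
      case True
      have "p f * p g * (M - ?d f g) \<le> p f * p g * M"
        using fg by (intro mult_left_mono) auto
      then show ?thesis using True fg by (simp add: mult.commute)
    next
      case False
      then have "p f * p g * (M - ?d f g) \<le> 0" using fg by (intro mult_nonneg_nonpos) auto
      then show ?thesis using False fg by simp
    qed
  qed
  also have "\<dots> = (\<Sum>e\<in>R'. M * (p (fst e) * p (snd e)))"
    using finR by (subst sum.inter_restrict[symmetric]) (auto simp: R_def R'_def intro!: sum.cong)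
  also have "\<dots> = M * (\<Sum>(f, g)\<in>R'. p f * p g)"
    by (simp add: sum_distrib_left case_prod_beta)
  finally have "(M - real (card U) / 2) / real k \<le> M * (\<Sum>(f, g)\<in>R'. p f * p g)" by simp
  then have "(M - real (card U) / 2) / real k / M \<le> (\<Sum>(f, g)\<in>R'. p f * p g)"
    using M by (subst pos_divide_le_eq) (auto simp: mult.commute)
  then show ?thesis
    unfolding R'_def[symmetric] divide_divide_eq_left by (simp add: mult.commute)
qed

section \<open>Numerical estimates\<close>

text \<open>Monotonicity of \<open>t * exp (- t)\<close> on \<open>(0, 1]\<close>, obtained from
  \<open>ln z \<le> z - 1\<close> at \<open>z = q / r\<close>. It shows that the smallest allowed
  \<open>q\<close> is the worst case in the next estimates.\<close>

lemma mult_exp_minus_mono: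
  fixes q r :: real
  assumes "0 < q" "q \<le> r" "r \<le> 1"
  shows "q * exp (- q) \<le> r * exp (- r)"
proof -
  have "(r - q) * r \<le> r - q" using assms by (intro mult_left_le) auto
  then have "r - q \<le> (r - q) / r" using assms by (subst pos_le_divide_eq) auto
  also have "\<dots> = 1 - q / r" using assms by (simp add: field_simps)
  also have "\<dots> \<le> - ln (q / r)" using ln_le_minus_one[of "q / r"] assms by simp
  also have "\<dots> = ln r - ln q" using assms by (simp add: ln_div)
  finally have "ln q - q \<le> ln r - r" by simp
  then have "exp (ln q - q) \<le> exp (ln r - r)" by simp
  then show ?thesis using assms by (simp add: exp_diff exp_minus divide_inverse)
qed

text \<open>The inequality \<open>ln z \<le> z - 1\<close> is applied at
  \<open>z = a / (a - 1)\<close>, the reciprocal of \<open>1 - 1 / a\<close>, so that it bounds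
  \<open>ln (1 - 1 / a)\<close> from below.\<close>

lemma power_ge_exp:
  fixes a :: real
  assumes "1 < a"
  shows "exp (- real m / (a - 1)) \<le> (1 - 1 / a) ^ m"
proof -
  have "1 - a / (a - 1) \<le> ln ((a - 1) / a)"
    using ln_le_minus_one[of "a / (a - 1)"] assms by (simp add: ln_div)
  moreover have "1 - a / (a - 1) = - (1 / (a - 1))" "(a - 1) / a = 1 - 1 / a"
    using assms by (auto simp: field_simps)
  ultimately have "- (1 / (a - 1)) \<le> ln (1 - 1 / a)" by simp
  moreover have "0 < 1 - 1 / a" using assms by simp
  ultimately have "exp (- (1 / (a - 1))) \<le> 1 - 1 / a"
    using ln_ge_iff by blast
  then have "exp (- (1 / (a - 1))) ^ m \<le> (1 - 1 / a) ^ m"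
    by (intro power_mono) auto
  then show ?thesis by (simp add: exp_of_nat_mult[symmetric])
qed

text \<open>With \<open>q\<close> the mean of \<open>1 - u\<close> and \<open>1 - v\<close>, their
  product is \<open>q^2 - (u - v)^2 / 4\<close>, at least \<open>3 / 4 * q^2\<close> since
  \<open>\<bar>u - v\<bar> \<le> \<delta> / 8 \<le> q\<close>. As
  \<open>exp (u + v) = exp 2 * exp (- (2 * q))\<close>, what remains is the square of
  \<open>q * exp (- q)\<close>, smallest at \<open>q = \<delta> / 8\<close>.\<close>

lemma balanced_product_ge:
  fixes u v \<delta> :: real
  assumes "0 < \<delta>" "0 \<le> u" "0 \<le> v" "u + v \<le> 2 - \<delta> / 4" "\<bar>u - v\<bar> \<le> \<delta> / 8"
  shows "3 / 256 * \<delta>\<^sup>2 * exp (2 - \<delta> / 4) \<le> (1 - u) * (1 - v) * exp (u + v)"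
proof -
  define q where "q = 1 - u / 2 - v / 2"
  have "\<delta> / 8 \<le> q" using assms(4) unfolding q_def by linarith
  moreover have "q \<le> 1" using assms(2,3) unfolding q_def by simp
  ultimately have q: "\<delta> / 8 \<le> q" "q \<le> 1" .
  have "(u - v)\<^sup>2 \<le> (\<delta> / 8)\<^sup>2" using assms by (metis abs_le_square_iff abs_of_pos divide_pos_pos zero_less_numeral)
  also have "\<dots> \<le> q\<^sup>2" using q assms by (intro power_mono) auto
  finally have "3 / 4 * q\<^sup>2 \<le> q\<^sup>2 - (u - v)\<^sup>2 / 4" by simp
  also have "\<dots> = (1 - u) * (1 - v)" by (simp add: q_def field_simps power2_eq_square)
  finally have uv: "3 / 4 * q\<^sup>2 \<le> (1 - u) * (1 - v)" .
  have "\<delta> / 8 * exp (- (\<delta> / 8)) \<le> q * exp (- q)"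
    by (intro mult_exp_minus_mono) (use q assms(1) in auto)
  then have "(\<delta> / 8 * exp (- (\<delta> / 8)))\<^sup>2 \<le> (q * exp (- q))\<^sup>2"
    using assms by (intro power_mono) auto
  then have "\<delta>\<^sup>2 / 64 * exp (- (\<delta> / 4)) \<le> q\<^sup>2 * exp (- (2 * q))"
    by (simp add: power_mult_distrib power_divide flip: exp_double)
  then have "exp 2 * (\<delta>\<^sup>2 / 64 * exp (- (\<delta> / 4))) \<le> exp 2 * (q\<^sup>2 * exp (- (2 * q)))"
    by (intro mult_left_mono) auto
  moreover have "exp (2 - \<delta> / 4) = exp 2 * exp (- (\<delta> / 4))" "exp (u + v) = exp 2 * exp (- (2 * q))"
    by (simp_all add: q_def field_simps flip: exp_add)
  ultimately have "3 / 256 * \<delta>\<^sup>2 * exp (2 - \<delta> / 4) \<le> 3 / 4 * q\<^sup>2 * exp (u + v)"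
    by (simp add: algebra_simps)
  also have "\<dots> \<le> (1 - u) * (1 - v) * exp (u + v)"
    using uv by (intro mult_right_mono) auto
  finally show ?thesis .
qed

text \<open>The threshold \<open>4096000000 = 1600 * 1600\<^sup>2\<close> makes the at most \<open>1600\<^sup>2\<close> pairs of heavy labels cost at most
  one percent of \<open>1 - u\<close> and \<open>1 - v\<close>, which are at least \<open>\<delta> / 16\<close>.\<close>

lemma avoidance_factor_ge:
  fixes u v \<delta> n :: real
  assumes \<delta>: "0 < \<delta>" "\<delta> < 4" and uv: "0 \<le> u" "0 \<le> v" "u + v \<le> 2 - \<delta> / 4" "\<bar>u - v\<bar> \<le> \<delta> / 8"
    and n: "4096000000 / \<delta> \<le> n" and m: "real m \<le> (4 - \<delta> - u - v) * n"
  shows "\<delta>\<^sup>2 / 16 * exp (- 4 + \<delta> / 2)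
    \<le> (1 - (v * n + 1600\<^sup>2) / n) * (1 - u * n / (n - 1600)) * (1 - 1 / (n - 2 * (n / 400))) ^ m"
proof -
  have n\<delta>: "4096000000 \<le> n * \<delta>" using n \<delta> by (simp add: pos_divide_le_eq)
  have "4096000000 / 4 \<le> 4096000000 / \<delta>" using \<delta> by (intro divide_left_mono) auto
  then have n1: "1024000000 \<le> n" using n by simp
  have "2560000 / n \<le> \<delta> / 1600" using n\<delta> n1 by (simp add: field_simps)
  \<comment> \<open>Twice \<open>u\<close> is \<open>(u + v) + (u - v)\<close>, so
    \<open>u \<le> 1 - \<delta> / 8 + \<delta> / 16\<close>; likewise for \<open>v\<close>.\<close>
  moreover have uv': "\<delta> / 16 \<le> 1 - u" "\<delta> / 16 \<le> 1 - v" using uv by (auto simp: abs_if split: if_splits)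
  ultimately have K: "2560000 / n \<le> (1 - v) / 100" "2560000 / n \<le> (1 - u) / 100" by auto
  have f1: "99 / 100 * (1 - v) \<le> 1 - (v * n + 1600\<^sup>2) / n"
    using K n1 by (simp add: add_divide_distrib)
  have "99 / 100 * (1 - u) \<le> 1 - u - 1600 / n"
    using K n1 by (simp add: field_simps)
  also have "\<dots> = (n - 1600 - u * n) / n" using n1 by (simp add: field_simps)
  also have "\<dots> \<le> (n - 1600 - u * n) / (n - 1600)"
  proof (rule divide_left_mono)
    have "0 \<le> 1 - u - 1600 / n" using K n1 uv' \<delta> by (simp add: field_simps)
    then show "0 \<le> n - 1600 - u * n" using n1 by (simp add: field_simps)
  qed (use n1 in auto)
  also have "\<dots> = 1 - u * n / (n - 1600)" using n1 by (simp add: field_simps)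
  finally have f2: "99 / 100 * (1 - u) \<le> 1 - u * n / (n - 1600)" .
  let ?a = "n - 2 * (n / 400)"
  have a: "99 / 100 * n \<le> ?a - 1" using n1 by simp
  have "real m / (?a - 1) \<le> real m / (99 / 100 * n)"
    using a n1 by (intro divide_left_mono) auto
  also have "\<dots> = 100 / 99 * (real m / n)" by simp
  also have "\<dots> \<le> 100 / 99 * (4 - \<delta> - u - v)"
    using m n1 by (intro mult_left_mono) (auto simp: field_simps)
  \<comment> \<open>The excess is one 99th of \<open>4 - \<delta> - u - v\<close>, which is at most
    \<open>4\<close>.\<close>
  also have "\<dots> \<le> (4 - \<delta> - u - v) + 4 / 99" using uv \<delta> by simp
  finally have "- (4 - \<delta> - u - v) - 4 / 99 \<le> - real m / (?a - 1)" by simp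
  then have "exp (- (4 - \<delta> - u - v) - 4 / 99) \<le> exp (- real m / (?a - 1))" by simp
  also have "\<dots> \<le> (1 - 1 / ?a) ^ m" using n1 by (intro power_ge_exp) auto
  finally have f3: "exp (- (4 - \<delta> - u - v) - 4 / 99) \<le> (1 - 1 / ?a) ^ m" .

  have e2: "25 / 4 \<le> exp (2 :: real)"
  proof -
    have "5 / 2 \<le> exp (1 :: real)" using exp_lower_Taylor_quadratic[of "1 :: real"] by simp
    then have "(5 / 2)\<^sup>2 \<le> (exp (1 :: real))\<^sup>2" by (intro power_mono) auto
    then show ?thesis by (simp add: power2_eq_square flip: exp_add)
  qed
  have e99: "95 / 99 \<le> exp (- 4 / 99 :: real)" using exp_ge_add_one_self[of "- 4 / 99 :: real"] by simp
  \<comment> \<open>The product bounded here is the ratio of the available lower bound to the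
    target: \<open>9801 / 10000\<close> and \<open>exp (- 4 / 99)\<close> are the losses for finite
    \<open>n\<close>, and \<open>3 / 16\<close> compares \<open>3 / 256\<close> with
    \<open>1 / 16\<close>. The factor \<open>exp 2\<close> more than compensates.\<close>
  have "1 \<le> 9801 / 10000 * (95 / 99) * (3 / 16) * (25 / 4 :: real)" by simp
  also have "\<dots> \<le> 9801 / 10000 * exp (- 4 / 99) * (3 / 16) * exp 2"
    using e2 e99 by (intro mult_mono) auto
  also have "\<dots> \<le> 9801 / 10000 * exp (- 4 / 99) * (3 / 16) * exp 2 * exp (\<delta> / 4)"
    using \<delta> by simp
  finally have c: "1 \<le> 9801 / 10000 * exp (- 4 / 99) * (3 / 16) * exp 2 * exp (\<delta> / 4)" .
  have "\<delta>\<^sup>2 / 16 * exp (- 4 + \<delta> / 2) * 1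
      \<le> \<delta>\<^sup>2 / 16 * exp (- 4 + \<delta> / 2) * (9801 / 10000 * exp (- 4 / 99) * (3 / 16) * exp 2 * exp (\<delta> / 4))"
    using c by (intro mult_left_mono) auto
  also have "\<dots> = 9801 / 10000 * (3 / 256 * \<delta>\<^sup>2 * exp (2 - \<delta> / 4)) * exp (- (4 - \<delta>) - 4 / 99)"
    by (simp add: exp_add exp_diff exp_minus field_simps) (simp add: field_simps flip: exp_add)
  also have "\<dots> \<le> 9801 / 10000 * ((1 - u) * (1 - v) * exp (u + v)) * exp (- (4 - \<delta>) - 4 / 99)"
    using balanced_product_ge[OF \<delta>(1) uv] by (intro mult_right_mono mult_left_mono) auto
  also have "\<dots> = (99 / 100 * (1 - v)) * (99 / 100 * (1 - u)) * exp (- (4 - \<delta> - u - v) - 4 / 99)"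
  proof -
    have "exp (- (4 - \<delta> - u - v) - 4 / 99) = exp (u + v) * exp (- (4 - \<delta>) - 4 / 99)"
      unfolding exp_add[symmetric] by (rule arg_cong[where f = exp]) simp
    moreover have "9801 / 10000 * (a * b * x) * y = (99 / 100 * b) * (99 / 100 * a) * (x * y)"
      for a b x y :: real by simp
    ultimately show ?thesis by metis
  qed
  also have "\<dots> \<le> (1 - (v * n + 1600\<^sup>2) / n) * (1 - u * n / (n - 1600)) * (1 - 1 / ?a) ^ m"
  proof -
    have nn: "0 \<le> 99 / 100 * (1 - v)" "0 \<le> 99 / 100 * (1 - u)" using uv' \<delta> by auto
    note pos = order_trans[OF nn(1) f1] order_trans[OF nn(2) f2]
    show ?thesis
      by (rule mult_mono[OF mult_mono[OF f1 f2 pos(1) nn(2)] f3 mult_nonneg_nonneg[OF pos] exp_ge_zero])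
  qed
  finally show ?thesis by simp
qed

section \<open>Reduction to finitely many schedules\<close>

lemma meeting_time_gt_iff:
  assumes "0 \<le> T"
  shows "ereal_of_enat (meeting_time x y \<pi>) > ereal T \<longleftrightarrow> (\<forall>t\<in>{1..nat \<lfloor>T\<rfloor>}. x t \<noteq> \<pi> (y t))"
proof
  assume gt: "ereal_of_enat (meeting_time x y \<pi>) > ereal T"
  show "\<forall>t\<in>{1..nat \<lfloor>T\<rfloor>}. x t \<noteq> \<pi> (y t)"
  proof (intro ballI notI)
    fix t assume t: "t \<in> {1..nat \<lfloor>T\<rfloor>}" "x t = \<pi> (y t)"
    then have "meeting_time x y \<pi> \<le> enat t"
      unfolding meeting_time_def by (intro Inf_lower) auto
    then have "ereal_of_enat (meeting_time x y \<pi>) \<le> ereal_of_enat (enat t)"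
      by (simp only: ereal_of_enat_le_iff)
    also have "\<dots> \<le> ereal T"
      using t assms by (simp add: le_nat_iff le_floor_iff)
    finally show False using gt by simp
  qed
next
  assume no: "\<forall>t\<in>{1..nat \<lfloor>T\<rfloor>}. x t \<noteq> \<pi> (y t)"
  let ?M = "{enat t | t. t \<ge> 1 \<and> x t = \<pi> (y t)}"
  show "ereal_of_enat (meeting_time x y \<pi>) > ereal T"
  proof (cases "?M = {}")
    case True
    \<comment> \<open>Players who never meet have the infimum of the empty set as meeting time,
      which in \<open>enat\<close> is \<open>\<infinity>\<close>.\<close>
    show ?thesis unfolding meeting_time_def True by (simp add: top_enat_def)
  next
    case False
    then obtain m where "m \<in> ?M" by blast
    then have "Inf ?M \<in> ?M" by (rule wellorder_InfI)
    then obtain t where t: "meeting_time x y \<pi> = enat t" "t \<ge> 1" "x t = \<pi> (y t)"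
      unfolding meeting_time_def by blast
    then have "nat \<lfloor>T\<rfloor> < t" using no by force
    then have "T < real t" using assms by linarith
    then show ?thesis using t by simp
  qed
qed

lemma measure_pair_times:
  assumes "sigma_finite_measure M2" "A \<in> sets M1" "B \<in> sets M2"
  shows "measure (M1 \<Otimes>\<^sub>M M2) (A \<times> B) = measure M1 A * measure M2 B"
  using assms by (simp add: measure_def sigma_finite_measure.emeasure_pair_measure_Times enn2real_mult)

text \<open>The event depends on the schedules only through their first \<open>N\<close> steps. It
  is therefore a finite disjoint union of rectangles
  \<open>C f \<times> (C g \<times> {\<pi>})\<close>, with \<open>\<pi>\<close> avoiding the pairs
  \<open>(g t, f t)\<close>, and independence turns each into a product of three
  probabilities.\<close>

lemma measure_meeting_time_gt:
  fixes n :: nat and D :: "(nat \<Rightarrow> nat) measure" and T :: real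
  defines "N \<equiv> nat \<lfloor>T\<rfloor>" and "W \<equiv> PiE {1..nat \<lfloor>T\<rfloor>} (\<lambda>_. {1..n})"
    and "p \<equiv> \<lambda>f. measure D {x \<in> space D. restrict x {1..nat \<lfloor>T\<rfloor>} = f}"
  assumes D: "symmetric_strategy n D" and T: "0 \<le> T"
  shows "(\<Sum>f\<in>W. p f) = 1"
    and "measure (rendezvous_measure n D)
        {(x, y, \<pi>) \<in> space (rendezvous_measure n D). ereal_of_enat (meeting_time x y \<pi>) > ereal T}
      = (\<Sum>(f, g)\<in>W \<times> W. p f * p g * (real (card (avoiding {1..n} ((\<lambda>t. (g t, f t)) ` {1..N}))) / fact n))"
proof -
  define C where "C = (\<lambda>f. {x \<in> space D. restrict x {1..N} = f})"
  define S where "S = {\<pi>. \<pi> permutes {1..n}}"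
  define Q where "Q = uniform_count_measure S"
  let ?av = "\<lambda>f g. avoiding {1..n} ((\<lambda>t. (g t, f t)) ` {1..N})"
  have finS: "finite S" and "S \<noteq> {}" and cardS: "card S = fact n"
    by (auto simp: S_def finite_permutations card_permutations intro: permutes_id)
  then interpret Q: prob_space Q unfolding Q_def by (intro prob_space_uniform_count_measure)
  interpret D: prob_space D using D by (simp add: symmetric_strategy_def)
  have setsD: "sets D = sets (schedule_space n)" using D by (simp add: symmetric_strategy_def)
  note spaceD = sets_eq_imp_space_eq[OF setsD]
  have finW: "finite W" by (simp add: W_def finite_PiE)
  have C_sets: "C f \<in> sets D" if "f \<in> W" for f
  proof -
    \<comment> \<open>The cell of a prefix is given by finitely many coordinate conditions, hence
      measurable although schedules are infinite.\<close>
    have "C f = {x \<in> space (schedule_space n). \<forall>t\<in>{1..N}. x t = f t}"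
      using that unfolding C_def spaceD W_def N_def[symmetric]
      by (auto simp: fun_eq_iff PiE_def extensional_def restrict_def)
    also have "\<dots> \<in> sets (schedule_space n)"
    proof (rule sets.sets_Collect_finite_All)
      fix t assume t: "t \<in> {1..N}"
      have "(\<lambda>x. x t) \<in> schedule_space n \<rightarrow>\<^sub>M count_space {1..n}"
        unfolding schedule_space_def using t by (intro measurable_component_singleton) auto
      moreover have "f t \<in> {1..n}" using that t by (auto simp: W_def N_def)
      ultimately have "(\<lambda>x. x t) -` {f t} \<inter> space (schedule_space n) \<in> sets (schedule_space n)"
        by (intro measurable_sets) auto
      also have "(\<lambda>x. x t) -` {f t} \<inter> space (schedule_space n) = {x \<in> space (schedule_space n). x t = f t}"
        by auto
      finally show "{x \<in> space (schedule_space n). x t = f t} \<in> sets (schedule_space n)" .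
    qed simp
    finally show ?thesis using setsD by simp
  qed
  have restr: "restrict x {1..N} \<in> W" if "x \<in> space D" for x
    using that unfolding spaceD schedule_space_def W_def N_def[symmetric]
    by (auto simp: space_PiM PiE_def)
  have p_eq: "p f = measure D (C f)" for f by (simp add: p_def C_def N_def)
  have "(\<Sum>f\<in>W. p f) = measure D (\<Union>f\<in>W. C f)"
    unfolding p_eq by (rule D.finite_measure_finite_Union[symmetric])
      (use finW C_sets in \<open>auto simp: disjoint_family_on_def C_def\<close>)
  also have "(\<Union>f\<in>W. C f) = space D" using restr by (auto simp: C_def)
  finally show "(\<Sum>f\<in>W. p f) = 1" by (simp add: D.prob_space)

  define I where "I = Sigma (W \<times> W) (\<lambda>(f, g). ?av f g)"
  define R where "R = (\<lambda>((f, g), \<pi> :: nat \<Rightarrow> nat). C f \<times> (C g \<times> {\<pi>}))"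
  have finav: "finite (?av f g)" for f g by (rule finite_avoiding) simp
  have avS: "?av f g \<subseteq> S" for f g by (auto simp: avoiding_def S_def)
  have "{(x, y, \<pi>) \<in> space (rendezvous_measure n D). ereal_of_enat (meeting_time x y \<pi>) > ereal T}
      = (\<Union>i\<in>I. R i)"
    (is "?L = _")
  proof (intro set_eqI iffI)
    fix z assume "z \<in> ?L"
    then obtain x y \<pi> where z: "z = (x, y, \<pi>)" "x \<in> space D" "y \<in> space D" "\<pi> \<in> S"
        and no: "\<forall>t\<in>{1..N}. x t \<noteq> \<pi> (y t)"
      unfolding meeting_time_gt_iff[OF T] N_def rendezvous_measure_def
      by (auto simp: space_pair_measure S_def space_uniform_count_measure)
    let ?f = "restrict x {1..N}" and ?g = "restrict y {1..N}"
    have "((?f, ?g), \<pi>) \<in> I"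
      using z no restr by (auto simp: I_def avoiding_def S_def)
    moreover have "z \<in> R ((?f, ?g), \<pi>)" using z by (simp add: R_def C_def)
    ultimately show "z \<in> (\<Union>i\<in>I. R i)" by blast
  next
    fix z assume "z \<in> (\<Union>i\<in>I. R i)"
    then obtain x y \<pi> where z: "z = (x, y, \<pi>)" "x \<in> space D" "y \<in> space D"
      and \<pi>: "\<pi> \<in> ?av (restrict x {1..N}) (restrict y {1..N})"
      by (auto simp: I_def R_def C_def)
    have "\<pi> \<in> S" using \<pi> avS by blast
    moreover have "\<forall>t\<in>{1..N}. x t \<noteq> \<pi> (y t)"
      using \<pi> by (auto simp: avoiding_def)
    ultimately show "z \<in> ?L"
      using z unfolding meeting_time_gt_iff[OF T] N_def rendezvous_measure_def
      by (auto simp: space_pair_measure S_def space_uniform_count_measure)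
  qed
  moreover have rm: "rendezvous_measure n D = D \<Otimes>\<^sub>M (D \<Otimes>\<^sub>M Q)"
    by (simp add: rendezvous_measure_def Q_def S_def)
  interpret DQ: pair_prob_space D Q ..
  interpret DDQ: pair_prob_space D "D \<Otimes>\<^sub>M Q" ..
  have sing: "{\<pi>} \<in> sets Q" "measure Q {\<pi>} = 1 / fact n" if "\<pi> \<in> S" for \<pi>
    using that finS cardS by (auto simp: Q_def sets_uniform_count_measure measure_uniform_count_measure)
  have R_sets: "R i \<in> sets (D \<Otimes>\<^sub>M (D \<Otimes>\<^sub>M Q))" if "i \<in> I" for i
    using that avS sing C_sets by (force simp: R_def I_def)
  have finI: "finite I" unfolding I_def using finW finav by (intro finite_SigmaI) auto
  have "disjoint_family_on R I"
    by (auto simp: disjoint_family_on_def R_def C_def)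
  then have "measure (D \<Otimes>\<^sub>M (D \<Otimes>\<^sub>M Q)) (\<Union>i\<in>I. R i) = (\<Sum>i\<in>I. measure (D \<Otimes>\<^sub>M (D \<Otimes>\<^sub>M Q)) (R i))"
    using finI R_sets by (intro DDQ.P.finite_measure_finite_Union) auto
  also have "\<dots> = (\<Sum>((f, g), \<pi>)\<in>I. p f * p g * (1 / fact n))"
  proof (intro sum.cong refl, clarify)
    fix f g \<pi> assume "((f, g), \<pi>) \<in> I"
    then have i: "f \<in> W" "g \<in> W" "\<pi> \<in> S" using avS by (auto simp: I_def)
    show "measure (D \<Otimes>\<^sub>M (D \<Otimes>\<^sub>M Q)) (R ((f, g), \<pi>)) = p f * p g * (1 / fact n)"
      using i C_sets sing unfolding R_def prod.case
      by (simp add: measure_pair_times DQ.P.sigma_finite_measure_axioms Q.sigma_finite_measure_axioms p_eq)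
  qed
  also have "\<dots> = (\<Sum>(f, g)\<in>W \<times> W. \<Sum>\<pi>\<in>?av f g. p f * p g * (1 / fact n))"
    unfolding I_def using finW finav by (subst sum.Sigma[symmetric]) (auto simp: case_prod_beta)
  also have "\<dots> = (\<Sum>(f, g)\<in>W \<times> W. p f * p g * (real (card (?av f g)) / fact n))"
    by (intro sum.cong refl) (auto simp: mult_ac)
  ultimately show "measure (rendezvous_measure n D)
        {(x, y, \<pi>) \<in> space (rendezvous_measure n D). ereal_of_enat (meeting_time x y \<pi>) > ereal T}
      = (\<Sum>(f, g)\<in>W \<times> W. p f * p g * (real (card (avoiding {1..n} ((\<lambda>t. (g t, f t)) ` {1..N}))) / fact n))"
    unfolding rm by simp
qed

section \<open>The lower bound\<close>

lemma balanced_schedules_avoidance_ge: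
  fixes f g :: "nat \<Rightarrow> nat" and n N :: nat and \<delta> :: real
  defines "A \<equiv> heavy_times N (real n / 400) f" and "B \<equiv> heavy_times N (real n / 400) g"
  assumes \<delta>: "0 < \<delta>" "\<delta> < 4" and n: "4096000000 / \<delta> \<le> real n"
    and N: "real N \<le> (4 - \<delta>) * real n"
    and fg: "f ` {1..N} \<subseteq> {1..n}" "g ` {1..N} \<subseteq> {1..n}"
    and diff: "real (card (sym_diff A B)) \<le> (2 - \<delta> / 4) * real n"
    and bal: "\<bar>real (card A) - real (card B)\<bar> \<le> \<delta> / 8 * real n"
  shows "\<delta>\<^sup>2 / 16 * exp (- 4 + \<delta> / 2)
    \<le> real (card (avoiding {1..n} ((\<lambda>t. (g t, f t)) ` {1..N}))) / fact n"
proof -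
  define u where "u = real (card (A - B)) / real n"
  define v where "v = real (card (B - A)) / real n"
  have n\<delta>: "4096000000 \<le> real n * \<delta>" using n \<delta> by (simp add: pos_divide_le_eq)
  have "4096000000 / 4 \<le> 4096000000 / \<delta>" using \<delta> by (intro divide_left_mono) auto
  then have n1: "1024000000 \<le> real n" using n by simp
  then have n0: "0 < real n" by simp
  have un: "u * real n = real (card (A - B))" and vn: "v * real n = real (card (B - A))"
    using n1 by (auto simp: u_def v_def)
  have AN: "A \<subseteq> {1..N}" "B \<subseteq> {1..N}" unfolding A_def B_def by (rule heavy_times_subset)+
  then have fin: "finite A" "finite B" by (auto intro: finite_subset)
  have sd: "card (sym_diff A B) = card (A - B) + card (B - A)"
    using fin by (intro card_Un_disjoint) auto
  have "card A = card (A - B) + card (A \<inter> B)" "card B = card (B - A) + card (A \<inter> B)"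
    using fin by (metis Diff_Int_distrib card_Int_Diff add.commute Int_commute)+
  then have AB: "real (card A) - real (card B) = (u - v) * real n"
    by (simp add: left_diff_distrib un vn)
  have uv: "0 \<le> u" "0 \<le> v" by (auto simp: u_def v_def)
  have "(u + v) * real n \<le> (2 - \<delta> / 4) * real n"
    using diff sd by (simp add: distrib_right un vn)
  then have sum: "u + v \<le> 2 - \<delta> / 4" using n0 by (rule mult_right_le_imp_le)
  have "\<bar>u - v\<bar> * real n \<le> \<delta> / 8 * real n"
    using bal unfolding AB by (simp add: abs_mult)
  then have dif: "\<bar>u - v\<bar> \<le> \<delta> / 8" using n0 by (rule mult_right_le_imp_le)
  have "card (sym_diff A B) \<le> card {1..N}" using AN by (intro card_mono) auto
  then have "real (N - card (sym_diff A B)) = real N - (u + v) * real n"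
    using sd by (simp add: of_nat_diff distrib_right un vn)
  then have m: "real (N - card (sym_diff A B)) \<le> (4 - \<delta> - u - v) * real n"
    using N by (simp add: algebra_simps)
  \<comment> \<open>At most \<open>4 * n\<close> steps, with \<open>n / 400\<close> of them at each
    heavy label, leave room for \<open>1600\<close> heavy labels.\<close>
  have K: "real (card (heavy N (real n / 400) x)) \<le> 1600" for x :: "nat \<Rightarrow> nat"
  proof -
    have "real (card (heavy N (real n / 400) x)) * (real n / 400) \<le> real N"
      using n1 by (intro card_heavy_le) simp
    also have "\<dots> \<le> 4 * real n"
      using N mult_right_mono[of "4 - \<delta>" 4 "real n"] \<delta> by linarith
    finally have "real (card (heavy N (real n / 400) x)) * real n \<le> 1600 * real n" by simp
    then show ?thesis using n0 by (rule mult_right_le_imp_le)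
  qed
  have "\<delta> / 16 \<le> 1 - u" using sum dif by linarith
  then have "\<delta> / 16 * real n \<le> (1 - u) * real n" by (intro mult_right_mono) auto
  moreover have "(1 - u) * real n = real n - real (card (A - B))" by (simp add: left_diff_distrib un)
  ultimately have un': "real (card (A - B)) \<le> real n - 1600"
    using n\<delta> by (simp add: mult.commute)
  have "fact n * (\<delta>\<^sup>2 / 16 * exp (- 4 + \<delta> / 2)) \<le> fact n *
      ((1 - (v * real n + 1600\<^sup>2) / real n) * (1 - u * real n / (real n - 1600))
        * (1 - 1 / (real n - 2 * (real n / 400))) ^ (N - card (sym_diff A B)))"
    using avoidance_factor_ge[OF \<delta> uv sum dif n m] by (intro mult_left_mono) auto
  also have "\<dots> \<le> real (card (avoiding {1..n} ((\<lambda>t. (g t, f t)) ` {1..N})))"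
    using card_avoiding_schedules_ge[of "{1..n}" f N g "real n / 400" 1600] fg K n1 un'
    by (simp add: un vn A_def B_def mult.assoc)
  finally show ?thesis by (simp add: pos_le_divide_eq mult.commute)
qed

text \<open>The constant is a product: the similar pairs \<open>R\<close> have weight at least
  \<open>\<delta>^2 / 256\<close>, and each of them avoids meeting with probability at least
  \<open>\<alpha>\<close>, which contributes \<open>\<delta>^2 / 16\<close> and the
  exponentials.\<close>

lemma meeting_time_gt_ge:
  fixes \<delta> :: real
  assumes \<delta>: "0 < \<delta>" "\<delta> < 4" and n: "4096000000 / \<delta> \<le> real n" and D: "symmetric_strategy n D"
  shows "exp (-4) / 4096 * exp (\<delta> / 2) * \<delta> ^ 4 \<le> measure (rendezvous_measure n D)
        {(x, y, \<pi>) \<in> space (rendezvous_measure n D).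
          ereal_of_enat (meeting_time x y \<pi>) > ereal ((4 - \<delta>) * real n)}"
proof -
  define T where "T = (4 - \<delta>) * real n"
  define N where "N = nat \<lfloor>T\<rfloor>"
  define W where "W = PiE {1..N} (\<lambda>_. {1..n})"
  define p where "p = (\<lambda>f. measure D {x \<in> space D. restrict x {1..N} = f})"
  define S where "S = (\<lambda>f :: nat \<Rightarrow> nat. heavy_times N (real n / 400) f)"
  define r where "r = (\<lambda>f. real (card (S f)) / (\<delta> / 8 * real n))"
  define b where "b = (\<lambda>f. nat \<lfloor>r f\<rfloor>)"
  \<comment> \<open>The sizes \<open>r f\<close>, in units of \<open>\<delta> / 8 * n\<close>, lie
    between \<open>0\<close> and \<open>(4 - \<delta>) / (\<delta> / 8) = 32 / \<delta> - 8\<close>;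
    the \<open>+ 1\<close> counts the class of floor \<open>0\<close>.\<close>
  define k where "k = nat \<lfloor>32 / \<delta> - 8\<rfloor> + 1"
  define M where "M = (2 - \<delta> / 4) * real n"
  define a where "a = (\<lambda>f g. real (card (avoiding {1..n} ((\<lambda>t. (g t, f t)) ` {1..N}))) / fact n :: real)"
  define \<alpha> where "\<alpha> = \<delta>\<^sup>2 / 16 * exp (- 4 + \<delta> / 2)"
  define R where "R = {(f, g) \<in> W \<times> W. b f = b g \<and> real (card (sym_diff (S f) (S g))) \<le> M}"
  have "0 < 4096000000 / \<delta>" using \<delta> by simp
  then have n0: "0 < real n" using n by linarith
  have T0: "0 \<le> T" using \<delta> by (simp add: T_def)
  then have NT: "real N \<le> (4 - \<delta>) * real n" by (simp add: N_def T_def)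
  have finW: "finite W" by (simp add: W_def finite_PiE)
  have S: "S f \<subseteq> {1..N}" for f unfolding S_def by (rule heavy_times_subset)
  have r0: "0 \<le> r f" for f using \<delta> by (simp add: r_def)
  have bk: "b f < k" for f
  proof -
    have "card (S f) \<le> N" using card_mono[OF _ S[of f]] by simp
    then have "real (card (S f)) \<le> (4 - \<delta>) * real n" using NT by linarith
    then have "r f \<le> (4 - \<delta>) * real n / (\<delta> / 8 * real n)"
      unfolding r_def using \<delta> by (intro divide_right_mono) auto
    also have "\<dots> = 32 / \<delta> - 8" using n0 \<delta> by (simp add: field_simps)
    finally have "\<lfloor>r f\<rfloor> \<le> \<lfloor>32 / \<delta> - 8\<rfloor>" by (rule floor_mono)
    then show ?thesis unfolding b_def k_def by linarith
  qed
  have "0 \<le> 32 / \<delta> - 8" using \<delta> by (simp add: field_simps)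
  then have k: "real k \<le> 32 / \<delta>" "0 < k" unfolding k_def by linarith+
  have p1: "(\<Sum>f\<in>W. p f) = 1"
    unfolding W_def p_def N_def by (rule measure_meeting_time_gt(1)[OF D T0])
  have p0: "0 \<le> p f" for f by (simp add: p_def)
  have M0: "0 < M" using n0 \<delta> by (simp add: M_def)
  have MN: "\<delta> / 4 * real n \<le> M - real (card {1..N}) / 2"
    using NT by (simp add: M_def algebra_simps)
  moreover have \<delta>n: "0 \<le> \<delta> / 4 * real n" using \<delta> by simp
  ultimately have NM: "real (card {1..N}) / 2 \<le> M" by linarith
  \<comment> \<open>Numerator: \<open>M - N / 2\<close> is at least
    \<open>(2 - \<delta> / 4) * n - (2 - \<delta> / 2) * n\<close>. Denominator:
    \<open>M \<le> 2 * n\<close> and \<open>k \<le> 32 / \<delta>\<close>.\<close>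
  have "\<delta>\<^sup>2 / 256 = (\<delta> / 4 * real n) / (2 * real n * (32 / \<delta>))"
    using n0 \<delta> by (simp add: field_simps power2_eq_square)
  also have "\<dots> \<le> (M - real (card {1..N}) / 2) / (M * real k)"
  proof (rule frac_le)
    show "M * real k \<le> 2 * real n * (32 / \<delta>)"
      using k \<delta> n0 unfolding M_def by (intro mult_mono) auto
  qed (use MN \<delta>n M0 k in auto)
  also have "\<dots> \<le> (\<Sum>(f, g)\<in>R. p f * p g)"
    unfolding R_def by (intro similar_pair_weight_ge finW S p0 p1 bk M0 NM) simp
  finally have R: "\<delta>\<^sup>2 / 256 \<le> (\<Sum>(f, g)\<in>R. p f * p g)" .
  have "exp (-4) / 4096 * exp (\<delta> / 2) * \<delta> ^ 4 = \<alpha> * (\<delta>\<^sup>2 / 256)"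
    unfolding \<alpha>_def exp_add by (simp add: power2_eq_square power4_eq_xxxx)
  also have "\<dots> \<le> \<alpha> * (\<Sum>(f, g)\<in>R. p f * p g)"
    using R by (intro mult_left_mono) (auto simp: \<alpha>_def)
  also have "\<dots> = (\<Sum>(f, g)\<in>R. p f * p g * \<alpha>)"
    by (simp add: sum_distrib_left case_prod_beta mult_ac)
  also have "\<dots> \<le> (\<Sum>(f, g)\<in>R. p f * p g * a f g)"
  proof (rule sum_mono, clarify)
    fix f g assume fg: "(f, g) \<in> R"
    then have "b f = b g" "f \<in> W" "g \<in> W" by (auto simp: R_def)
    then have "\<lfloor>r f\<rfloor> = \<lfloor>r g\<rfloor>" using r0[of f] r0[of g] by (simp add: b_def eq_nat_nat_iff)
    then have "\<bar>r f - r g\<bar> \<le> 1" by linarith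
    then have "\<bar>r f - r g\<bar> * (\<delta> / 8 * real n) \<le> 1 * (\<delta> / 8 * real n)"
      using \<delta> by (intro mult_right_mono) auto
    moreover have "real (card (S f)) - real (card (S g)) = (r f - r g) * (\<delta> / 8 * real n)"
      using n0 \<delta> by (simp add: r_def left_diff_distrib)
    then have "\<bar>real (card (S f)) - real (card (S g))\<bar> = \<bar>r f - r g\<bar> * (\<delta> / 8 * real n)"
      using \<delta> by (simp only: abs_mult)
    ultimately have "\<bar>real (card (S f)) - real (card (S g))\<bar> \<le> \<delta> / 8 * real n" by linarith
    then have "\<alpha> \<le> a f g"
      unfolding \<alpha>_def a_def using fg \<open>f \<in> W\<close> \<open>g \<in> W\<close>
      by (intro balanced_schedules_avoidance_ge \<delta> n NT) (auto simp: R_def M_def S_def W_def)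
    then show "p f * p g * \<alpha> \<le> p f * p g * a f g"
      using p0 by (intro mult_left_mono mult_nonneg_nonneg) auto
  qed
  also have "\<dots> \<le> (\<Sum>(f, g)\<in>W \<times> W. p f * p g * a f g)"
    using finW p0 by (intro sum_mono2) (auto simp: R_def a_def)
  also have "\<dots> = measure (rendezvous_measure n D)
        {(x, y, \<pi>) \<in> space (rendezvous_measure n D). ereal_of_enat (meeting_time x y \<pi>) > ereal T}"
    unfolding W_def p_def N_def a_def by (rule measure_meeting_time_gt(2)[OF D T0, symmetric])
  finally show ?thesis by (simp add: T_def)
qed

theorem theorem6:
  fixes \<delta> :: real
  assumes "0 < \<delta>" and "\<delta> < 4"
  shows "\<exists>\<epsilon> :: nat \<Rightarrow> real. \<epsilon> \<longlonglongrightarrow> 0 \<and>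
    (\<forall>n D. symmetric_strategy n D \<longrightarrow>
      measure (rendezvous_measure n D)
        {(x, y, \<pi>) \<in> space (rendezvous_measure n D).
          ereal_of_enat (meeting_time x y \<pi>) > ereal ((4 - \<delta>) * real n)}
      \<ge> exp (-4) / 4096 * exp (\<delta> / 2) * \<delta> ^ 4 - \<epsilon> n)"
proof -
  define c where "c = exp (-4) / 4096 * exp (\<delta> / 2) * \<delta> ^ 4"
  define \<epsilon> where "\<epsilon> = (\<lambda>n. if 4096000000 / \<delta> \<le> real n then 0 else c)"
  have "eventually (\<lambda>n. 4096000000 / \<delta> \<le> real n) sequentially"
    using filterlim_real_sequentially unfolding filterlim_at_top by blast
  then have "eventually (\<lambda>n. \<epsilon> n = 0) sequentially"
    by eventually_elim (simp add: \<epsilon>_def)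
  then have "\<epsilon> \<longlonglongrightarrow> 0" by (rule tendsto_eventually)
  moreover have "c - \<epsilon> n \<le> measure (rendezvous_measure n D)
        {(x, y, \<pi>) \<in> space (rendezvous_measure n D).
          ereal_of_enat (meeting_time x y \<pi>) > ereal ((4 - \<delta>) * real n)}"
    if "symmetric_strategy n D" for n D
    using meeting_time_gt_ge[OF assms _ that] by (auto simp: \<epsilon>_def c_def)
  ultimately show ?thesis unfolding c_def by blast
qed

end
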